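(* Let $G=(V,E)$ be a locally finite simple graph and let $x\in V$. Assume that $G$ is $S_1$-out regular at $x$, i.e. $d_{y_i}^+=av_1^+(x)$ for any $y_i\in S_1(x)$. Then for any $\mathcal N\in(0,\infty]$, $$\mathcal K_{G,x}(\mathcal N)=\mathcal K_\infty^0(x)-\frac{2d_x}{\mathcal N}+\frac12\lambda_{\min}\left(\mathcal P_\infty(x)+\frac4{\mathcal N}(d_xI_{d_x}-J_{d_x})\right).$$ More explicitly, $$\mathcal K_{G,x}(\mathcal N)=\begin{cases}\mathcal K_\infty^0(x)-\frac{2d_x}{\mathcal N},&\text{if }0<\mathcal N\le\mathcal N_0(x),\\[1mm]\mathcal K_\infty^0(x)-\frac{2d_x}{\mathcal N_0(x)},&\text{if }\mathcal N>\mathcal N_0(x),\end{cases}\qquad\text{where}\quad\mathcal N_0(x):=\frac{4d_x}{-\lambda_{\min}(\mathcal P_\infty(x))},$$ with $\mathcal N_0(x)=\infty$ when $\lambda_{\min}(\mathcal P_\infty(x))=0$.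
   Context: Graphs are undirected, without loops or multiple edges, and every vertex has finite degree; $d_x$ is the degree of $x$, and the vertex $x$ considered has $d_x\ge1$. For $f:V\to\mathbb R$ put $\Delta f(x)=\sum_{y\sim x}(f(y)-f(x))$ (non-normalized Laplacian), and for $f,g:V\to\mathbb R$ put $2\Gamma(f,g)=\Delta(fg)-f\Delta g-g\Delta f$, $2\Gamma_2(f,g)=\Delta\Gamma(f,g)-\Gamma(f,\Delta g)-\Gamma(\Delta f,g)$, $\Gamma(f)=\Gamma(f,f)$, $\Gamma_2(f)=\Gamma_2(f,f)$. For $\mathcal N\in(0,\infty]$ (convention $1/\infty=0$), $\mathcal K_{G,x}(\mathcal N)$ is the largest $K\in\mathbb R$ such that $\Gamma_2(f)(x)\ge\frac1{\mathcal N}(\Delta f(x))^2+K\,\Gamma(f)(x)$ for all $f:V\to\mathbb R$ (Bakry-Émery curvature function). $S_r(x)$ is the set of vertices at graph distance $r$ from $x$; $S_1(x)=\{y_1,\dots,y_{d_x}\}$. For $y\in S_1(x)$, $d_y^+$ is the number of neighbours of $y$ in $S_2(x)$; for $z\in S_2(x)$, $d_z^-$ is the number of neighbours of $z$ in $S_1(x)$; $w_{uv}=1$ if $u\sim v$ and $0$ otherwise. $av_1^+(x)=\frac1{d_x}\sum_{y\in S_1(x)}d_y^+$ and $\mathcal K_\infty^0(x)=\frac{3+d_x-av_1^+(x)}2$. $\mathcal P_\infty(x)$ is the symmetric $d_x\times d_x$ matrix with entries $(\mathcal P_\infty(x))_{ij}=2-4w_{y_iy_j}-4\sum_{z\in S_2(x)}\frac{w_{y_iz}w_{zy_j}}{d_z^-}$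 for $i\ne j$, and $(\mathcal P_\infty(x))_{ii}=-\sum_{j\ne i}(\mathcal P_\infty(x))_{ij}-(d_{y_i}^+-av_1^+(x))$. $I_{d_x}$ is the identity matrix, $J_{d_x}$ the all-ones matrix of size $d_x$, and $\lambda_{\min}$ denotes the smallest eigenvalue. (Under $S_1$-out regularity $\mathcal P_\infty(x)\mathbf 1=0$, so $\lambda_{\min}(\mathcal P_\infty(x))\le0$.) *)

theory Defs
  imports "Jordan_Normal_Form.Char_Poly" "HOL-Library.Extended_Nat" "HOL-Library.Extended_Real"
begin

text \<open>A simple graph is a vertex set \<open>V\<close> with a set \<open>E\<close> of two-element subsets of \<open>V\<close>.\<close>

definition simple_graph :: "'a set \<Rightarrow> 'a set set \<Rightarrow> bool" where
  "simple_graph V E \<longleftrightarrow> (\<forall>e\<in>E. e \<subseteq> V \<and> card e = 2)"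

definition nbrs :: "'a set set \<Rightarrow> 'a \<Rightarrow> 'a set" where
  "nbrs E u = {v. {u, v} \<in> E}"

definition locally_finite :: "'a set \<Rightarrow> 'a set set \<Rightarrow> bool" where
  "locally_finite V E \<longleftrightarrow> (\<forall>v\<in>V. finite (nbrs E v))"

definition vdeg :: "'a set set \<Rightarrow> 'a \<Rightarrow> nat" where
  "vdeg E u = card (nbrs E u)"

definition edge_weight :: "'a set set \<Rightarrow> 'a \<Rightarrow> 'a \<Rightarrow> real" where
  "edge_weight E u v = (if {u, v} \<in> E then 1 else 0)"

text \<open>Length of a shortest walk; it is \<open>\<infinity>\<close> (the infimum of the empty set) if there is no walk.\<close>

definition gdist :: "'a set set \<Rightarrow> 'a \<Rightarrow> 'a \<Rightarrow> enat" where
  "gdist E u v = (INF k \<in> {k. (u, v) \<in> {(a, b). {a, b} \<in> E} ^^ k}. enat k)"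

definition gsphere :: "'a set \<Rightarrow> 'a set set \<Rightarrow> nat \<Rightarrow> 'a \<Rightarrow> 'a set" where
  "gsphere V E r x = {v \<in> V. gdist E x v = enat r}"

text \<open>Functions on \<open>V\<close> are represented by functions on the whole type. At a vertex of \<open>V\<close> the
  operators below only involve values at vertices of \<open>V\<close>, since all neighbours lie in \<open>V\<close>.\<close>

definition laplacian :: "'a set set \<Rightarrow> ('a \<Rightarrow> real) \<Rightarrow> 'a \<Rightarrow> real" where
  "laplacian E f u = (\<Sum>v\<in>nbrs E u. f v - f u)"

definition Gamma_op :: "'a set set \<Rightarrow> ('a \<Rightarrow> real) \<Rightarrow> ('a \<Rightarrow> real) \<Rightarrow> 'a \<Rightarrow> real" where
  "Gamma_op E f g u =
     (laplacian E (\<lambda>v. f v * g v) u - f u * laplacian E g u - g u * laplacian E f u) / 2"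

definition Gamma2_op :: "'a set set \<Rightarrow> ('a \<Rightarrow> real) \<Rightarrow> ('a \<Rightarrow> real) \<Rightarrow> 'a \<Rightarrow> real" where
  "Gamma2_op E f g u =
     (laplacian E (Gamma_op E f g) u - Gamma_op E f (laplacian E g) u
        - Gamma_op E (laplacian E f) g u) / 2"

text \<open>The dimension parameter is an extended real; in \<open>ereal\<close> one has \<open>1 / \<infinity> = 0\<close>.\<close>

definition curvature_dim :: "'a set set \<Rightarrow> 'a \<Rightarrow> ereal \<Rightarrow> real \<Rightarrow> bool" where
  "curvature_dim E x N K \<longleftrightarrow>
     (\<forall>f. Gamma2_op E f f x
        \<ge> real_of_ereal (1 / N) * (laplacian E f x)\<^sup>2 + K * Gamma_op E f f x)"

definition BE_curvature :: "'a set set \<Rightarrow> 'a \<Rightarrow> ereal \<Rightarrow> real" where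
  "BE_curvature E x N = (GREATEST K. curvature_dim E x N K)"

definition out_deg :: "'a set \<Rightarrow> 'a set set \<Rightarrow> 'a \<Rightarrow> 'a \<Rightarrow> nat" where
  "out_deg V E x y = card (nbrs E y \<inter> gsphere V E 2 x)"

definition in_deg :: "'a set \<Rightarrow> 'a set set \<Rightarrow> 'a \<Rightarrow> 'a \<Rightarrow> nat" where
  "in_deg V E x z = card (nbrs E z \<inter> gsphere V E 1 x)"

definition avg_out_deg :: "'a set \<Rightarrow> 'a set set \<Rightarrow> 'a \<Rightarrow> real" where
  "avg_out_deg V E x = 1 / real (vdeg E x) * (\<Sum>y\<in>gsphere V E 1 x. real (out_deg V E x y))"

definition S1_out_regular :: "'a set \<Rightarrow> 'a set set \<Rightarrow> 'a \<Rightarrow> bool" where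
  "S1_out_regular V E x \<longleftrightarrow>
     (\<forall>y\<in>gsphere V E 1 x. real (out_deg V E x y) = avg_out_deg V E x)"

definition K0_infty :: "'a set \<Rightarrow> 'a set set \<Rightarrow> 'a \<Rightarrow> real" where
  "K0_infty V E x = (3 + real (vdeg E x) - avg_out_deg V E x) / 2"

definition P_offdiag :: "'a set \<Rightarrow> 'a set set \<Rightarrow> 'a \<Rightarrow> 'a \<Rightarrow> 'a \<Rightarrow> real" where
  "P_offdiag V E x u v = 2 - 4 * edge_weight E u v
     - 4 * (\<Sum>z\<in>gsphere V E 2 x. edge_weight E u z * edge_weight E z v / real (in_deg V E x z))"

text \<open>The matrix depends on an enumeration \<open>y\<close> of the 1-sphere, with indices starting at 0.\<close>

definition P_infty :: "'a set \<Rightarrow> 'a set set \<Rightarrow> 'a \<Rightarrow> (nat \<Rightarrow> 'a) \<Rightarrow> real mat" where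
  "P_infty V E x y = mat (vdeg E x) (vdeg E x) (\<lambda>(i, j).
     if i \<noteq> j then P_offdiag V E x (y i) (y j)
     else - (\<Sum>k\<in>{..<vdeg E x} - {i}. P_offdiag V E x (y i) (y k))
          - (real (out_deg V E x (y i)) - avg_out_deg V E x))"

definition ones_mat :: "nat \<Rightarrow> real mat" where
  "ones_mat n = mat n n (\<lambda>_. 1)"

text \<open>Only used for symmetric matrices of positive size, whose eigenvalues are all real, so that
  the set is finite and nonempty.\<close>

definition lambda_min :: "real mat \<Rightarrow> real" where
  "lambda_min A = Min {k. eigenvalue A k}"

definition N0_thr :: "'a set \<Rightarrow> 'a set set \<Rightarrow> 'a \<Rightarrow> (nat \<Rightarrow> 'a) \<Rightarrow> ereal" where
  "N0_thr V E x y =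
     (if lambda_min (P_infty V E x y) = 0 then \<infinity>
      else ereal (4 * real (vdeg E x) / (- lambda_min (P_infty V E x y))))"

end

(* With f(x) = 0, completing the square in the values f(z), z in S_2(x), writes 2 Gamma_2(f)(x) as
   K_infty^0 |v|^2 + (v . P_infty v) / 2 plus a sum of squares that vanishes for a suitable choice
   of f on S_2(x), where v is the vector of values of f on S_1(x). As 2 Gamma(f)(x) = |v|^2 and
   Delta f(x) is the sum of the entries of v, the curvature is governed by the least Rayleigh
   quotient of P_infty - (4/N) J. Under S_1-out regularity the constant vectors lie in the kernel
   of P_infty, so adding (4/N) (d I - J) shifts the spectrum by 4 d / N on their orthogonal
   complement only; this gives the explicit formula. *)

theory Submission
  imports Defs
begin

subsection \<open>The least eigenvalue of a real symmetric matrix\<close>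

text \<open>\<open>lambda_min\<close> is the \<open>Min\<close> of a set of eigenvalues, while the
  curvature inequality bounds a quadratic form, so the infimum of the Rayleigh quotient has to be
  shown to be an eigenvalue. The reason is coercivity: a positive semidefinite form with invertible
  matrix stays above a positive multiple of the squared norm. The three terms of
  \<open>P_offdiag\<close> have separate sources. The 2 comes from
  \<open>(Delta f)^2 - d |v|^2\<close> written as squared differences over pairs; the edge weight
  comes from walks inside the 1-sphere; the sum over the 2-sphere is the variance left over, at each
  \<open>z\<close>, when the square in \<open>f z\<close> is completed. The inequality itself only
  produces \<open>- (4 / N) J\<close>. The multiple of the identity is added so that constants stay
  in the kernel, and the term \<open>- 2 d / N\<close> of the formula pays for it. The least
  eigenvalue is then \<open>min 0 (lambda_min P + 4 d / N)\<close>, and a finite \<open>N0\<close>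
  is the value of \<open>N\<close> at which the second entry changes sign.\<close>

lemma quadratic_form_sum:
  fixes A :: "real mat"
  assumes "A \<in> carrier_mat n n" "v \<in> carrier_vec n"
  shows "v \<bullet> (A *\<^sub>v v) = (\<Sum>i<n. \<Sum>j<n. A $$ (i, j) * v $ i * v $ j)"
  using assms
  by (auto simp: scalar_prod_def sum_distrib_left ac_simps lessThan_atLeast0 intro!: sum.cong)

lemma scalar_prod_self_sum:
  fixes v :: "real vec"
  assumes "v \<in> carrier_vec n"
  shows "v \<bullet> v = (\<Sum>i<n. (v $ i)\<^sup>2)"
  using assms by (simp add: scalar_prod_def lessThan_atLeast0 power2_eq_square)

lemma scalar_prod_self_nonneg: "0 \<le> v \<bullet> (v :: real vec)"
  by (auto simp: scalar_prod_def intro: sum_nonneg)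

lemma scalar_prod_self_pos:
  fixes v :: "real vec"
  assumes "v \<in> carrier_vec n" "v \<noteq> 0\<^sub>v n"
  shows "0 < v \<bullet> v"
proof -
  obtain i where "i < n" "v $ i \<noteq> 0"
    using assms by (metis carrier_vecD eq_vecI index_zero_vec)
  then show ?thesis
    unfolding scalar_prod_self_sum[OF assms(1)]
    by (intro sum_pos2[of _ i]) auto
qed

lemma quadratic_form_bound:
  fixes B :: "real mat"
  assumes B: "B \<in> carrier_mat n n"
  obtains M where "M > 0" "\<And>v. v \<in> carrier_vec n \<Longrightarrow> \<bar>v \<bullet> (B *\<^sub>v v)\<bar> \<le> M * (v \<bullet> v)"
proof -
  \<comment> \<open>The summand 1 keeps \<open>M\<close> positive even for the zero matrix, so that
    \<open>1 / M\<close> may serve as a step length.\<close>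
  define M where "M = 1 + (\<Sum>i<n. \<Sum>j<n. \<bar>B $$ (i, j)\<bar>)"
  have "\<bar>v \<bullet> (B *\<^sub>v v)\<bar> \<le> M * (v \<bullet> v)" if v: "v \<in> carrier_vec n" for v
  proof -
    have entry: "\<bar>v $ i * v $ j\<bar> \<le> v \<bullet> v" if "i < n" "j < n" for i j
    proof -
      have sq: "(v $ k)\<^sup>2 \<le> v \<bullet> v" if "k < n" for k
        unfolding scalar_prod_self_sum[OF v] using that by (intro member_le_sum) auto
      have "2 * \<bar>v $ i * v $ j\<bar> \<le> (v $ i)\<^sup>2 + (v $ j)\<^sup>2"
        using sum_squares_bound[of "\<bar>v $ i\<bar>" "\<bar>v $ j\<bar>"] by (simp add: abs_mult)
      then show ?thesis using sq[OF that(1)] sq[OF that(2)] by linarith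
    qed
    have "\<bar>v \<bullet> (B *\<^sub>v v)\<bar> \<le> (\<Sum>i<n. \<Sum>j<n. \<bar>B $$ (i, j) * v $ i * v $ j\<bar>)"
      unfolding quadratic_form_sum[OF B v]
      by (intro order.trans[OF sum_abs] sum_mono order_refl)
    also have "\<dots> \<le> (\<Sum>i<n. \<Sum>j<n. \<bar>B $$ (i, j)\<bar> * (v \<bullet> v))"
    proof (intro sum_mono)
      fix i j assume "i \<in> {..<n}" "j \<in> {..<n}"
      then have "\<bar>B $$ (i, j)\<bar> * \<bar>v $ i * v $ j\<bar> \<le> \<bar>B $$ (i, j)\<bar> * (v \<bullet> v)"
        using entry by (intro mult_left_mono) auto
      then show "\<bar>B $$ (i, j) * v $ i * v $ j\<bar> \<le> \<bar>B $$ (i, j)\<bar> * (v \<bullet> v)"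
        by (simp add: abs_mult mult.assoc)
    qed
    also have "\<dots> \<le> M * (v \<bullet> v)"
      using scalar_prod_self_nonneg[of v]
      by (simp add: M_def sum_distrib_right[symmetric] distrib_right)
    finally show ?thesis .
  qed
  moreover have "M > 0" unfolding M_def by (intro add_pos_nonneg sum_nonneg) auto
  ultimately show ?thesis using that by blast
qed

lemma symmetric_scalar_prod:
  fixes B :: "real mat"
  assumes "B \<in> carrier_mat n n" "B\<^sup>T = B" "u \<in> carrier_vec n" "v \<in> carrier_vec n"
  shows "(B *\<^sub>v u) \<bullet> v = u \<bullet> (B *\<^sub>v v)"
  using transpose_vec_mult_scalar[of B n n v u] assms by simp

text \<open>Testing positivity on \<open>u - t B u\<close> for a small \<open>t\<close> bounds \<open>B u\<close> by the form itself.\<close>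

lemma psd_norm_bound:
  fixes B :: "real mat"
  assumes B: "B \<in> carrier_mat n n" and sym: "B\<^sup>T = B"
    and psd: "\<And>v. v \<in> carrier_vec n \<Longrightarrow> 0 \<le> v \<bullet> (B *\<^sub>v v)"
  obtains M where "M > 0"
    "\<And>u. u \<in> carrier_vec n \<Longrightarrow> (B *\<^sub>v u) \<bullet> (B *\<^sub>v u) \<le> M * (u \<bullet> (B *\<^sub>v u))"
proof -
  obtain M where M: "M > 0" "\<And>v. v \<in> carrier_vec n \<Longrightarrow> \<bar>v \<bullet> (B *\<^sub>v v)\<bar> \<le> M * (v \<bullet> v)"
    using quadratic_form_bound[OF B] by metis
  have "(B *\<^sub>v u) \<bullet> (B *\<^sub>v u) \<le> M * (u \<bullet> (B *\<^sub>v u))" if u: "u \<in> carrier_vec n" for u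
  proof -
    define w where "w = B *\<^sub>v u"
    \<comment> \<open>Once \<open>w . B w\<close> is bounded by \<open>M (w . w)\<close>, the
      coefficient of \<open>w . w\<close> is \<open>- 2 t + M t^2\<close>, which is smallest at
      \<open>t = 1 / M\<close>.\<close>
    define t where "t = 1 / M"
    have w: "w \<in> carrier_vec n" using B u by (simp add: w_def)
    have Bw: "B *\<^sub>v w \<in> carrier_vec n" using B w by simp
    let ?z = "u + (- t) \<cdot>\<^sub>v w"
    have "B *\<^sub>v ?z = w + (- t) \<cdot>\<^sub>v (B *\<^sub>v w)"
      using B u w by (simp add: w_def mult_add_distrib_mat_vec[OF B] mult_mat_vec[OF B])
    then have "?z \<bullet> (B *\<^sub>v ?z) =
        u \<bullet> w - t * (u \<bullet> (B *\<^sub>v w)) - t * (w \<bullet> w) + t * t * (w \<bullet> (B *\<^sub>v w))"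
      using u w Bw
      by (simp add: add_scalar_prod_distrib[of _ n] scalar_prod_add_distrib[of _ n] algebra_simps)
    moreover have "u \<bullet> (B *\<^sub>v w) = w \<bullet> w"
      using symmetric_scalar_prod[OF B sym u w] by (simp add: w_def)
    moreover have "0 \<le> ?z \<bullet> (B *\<^sub>v ?z)" using psd u w by simp
    ultimately have "0 \<le> u \<bullet> w - 2 * t * (w \<bullet> w) + t * t * (w \<bullet> (B *\<^sub>v w))"
      by (simp add: algebra_simps)
    also have "t * t * (w \<bullet> (B *\<^sub>v w)) \<le> t * t * (M * (w \<bullet> w))"
      using M(2)[OF w] by (intro mult_left_mono) auto
    also have "\<dots> = t * (w \<bullet> w)" using M(1) by (simp add: t_def)
    finally have "t * (w \<bullet> w) \<le> u \<bullet> w" by (simp add: algebra_simps)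
    then show ?thesis using M(1) by (simp add: t_def w_def field_simps)
  qed
  with M(1) that show ?thesis by blast
qed

text \<open>With \<open>C\<close> the inverse of \<open>B\<close>, the squared norm of
  \<open>u = C (B u)\<close> is the form of the transpose of \<open>C\<close> times \<open>C\<close>
  at \<open>B u\<close>, hence at most \<open>L\<close> times the squared norm of
  \<open>B u\<close>; \<open>psd_norm_bound\<close> controls the latter by \<open>M\<close> times
  the form of \<open>B\<close> at \<open>u\<close>.\<close>

lemma psd_invertible_coercive:
  fixes B :: "real mat"
  assumes B: "B \<in> carrier_mat n n" and sym: "B\<^sup>T = B" and det: "det B \<noteq> 0"
    and psd: "\<And>v. v \<in> carrier_vec n \<Longrightarrow> 0 \<le> v \<bullet> (B *\<^sub>v v)"
  obtains c where "c > 0" "\<And>u. u \<in> carrier_vec n \<Longrightarrow> c * (u \<bullet> u) \<le> u \<bullet> (B *\<^sub>v u)"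
proof -
  obtain M where M: "M > 0"
    "\<And>u. u \<in> carrier_vec n \<Longrightarrow> (B *\<^sub>v u) \<bullet> (B *\<^sub>v u) \<le> M * (u \<bullet> (B *\<^sub>v u))"
    using psd_norm_bound[OF B sym psd] by metis
  from det_non_zero_imp_unit[OF B det, unfolded Units_def, of "()"]
  obtain C where C: "C \<in> carrier_mat n n" "C * B = 1\<^sub>m n" by (auto simp: ring_mat_def)
  have "C\<^sup>T * C \<in> carrier_mat n n" using C by simp
  then obtain L where L: "L > 0"
    "\<And>v. v \<in> carrier_vec n \<Longrightarrow> \<bar>v \<bullet> ((C\<^sup>T * C) *\<^sub>v v)\<bar> \<le> L * (v \<bullet> v)"
    using quadratic_form_bound by metis
  have "1 / (L * M) * (u \<bullet> u) \<le> u \<bullet> (B *\<^sub>v u)" if u: "u \<in> carrier_vec n" for u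
  proof -
    define w where "w = B *\<^sub>v u"
    have w: "w \<in> carrier_vec n" using B u by (simp add: w_def)
    have Cw: "C *\<^sub>v w = u"
      unfolding w_def using B C u by (simp add: assoc_mult_mat_vec[symmetric])
    have "u \<bullet> u = w \<bullet> ((C\<^sup>T * C) *\<^sub>v w)"
      using transpose_vec_mult_scalar[of "C\<^sup>T" n n u w] C w u Cw
      by (simp add: assoc_mult_mat_vec[of "C\<^sup>T" n n C n w])
    also have "\<dots> \<le> L * (w \<bullet> w)" using L(2)[OF w] by simp
    also have "\<dots> \<le> L * (M * (u \<bullet> w))"
      using M(2)[OF u] L(1) by (intro mult_left_mono) (auto simp: w_def)
    finally show ?thesis using L(1) M(1) by (simp add: w_def field_simps)
  qed
  moreover have "1 / (L * M) > 0" using L(1) M(1) by simp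
  ultimately show ?thesis using that by blast
qed

text \<open>\<open>m\<close> is the infimum of the Rayleigh quotient: if \<open>A - m I\<close> were invertible, it would be
  coercive, and the infimum would exceed \<open>m\<close>.\<close>

lemma symmetric_least_eigenvalue:
  fixes A :: "real mat"
  assumes A: "A \<in> carrier_mat n n" and sym: "A\<^sup>T = A" and n: "0 < n"
  obtains m where "eigenvalue A m"
    "\<And>v. v \<in> carrier_vec n \<Longrightarrow> m * (v \<bullet> v) \<le> v \<bullet> (A *\<^sub>v v)"
proof -
  define S where "S = {v \<bullet> (A *\<^sub>v v) | v. v \<in> carrier_vec n \<and> v \<bullet> v = 1}"
  define m where "m = Inf S"
  have "unit_vec n 0 \<bullet> (A *\<^sub>v unit_vec n 0) \<in> S"
    unfolding S_def using n by (auto intro!: exI[of _ "unit_vec n 0"])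
  then have ne: "S \<noteq> {}" by blast
  obtain M where M: "\<And>v. v \<in> carrier_vec n \<Longrightarrow> \<bar>v \<bullet> (A *\<^sub>v v)\<bar> \<le> M * (v \<bullet> v)"
    using quadratic_form_bound[OF A] by metis
  have bdd: "bdd_below S"
  proof (rule bdd_belowI[of _ "- M"])
    fix s assume "s \<in> S"
    then obtain v where "v \<in> carrier_vec n" "v \<bullet> v = 1" "s = v \<bullet> (A *\<^sub>v v)" by (auto simp: S_def)
    then show "- M \<le> s" using M[of v] by simp
  qed
  have below: "m * (v \<bullet> v) \<le> v \<bullet> (A *\<^sub>v v)" if v: "v \<in> carrier_vec n" for v
  proof (cases "v = 0\<^sub>v n")
    case True
    then show ?thesis using A by simp
  next
    case False
    define r where "r = sqrt (v \<bullet> v)"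
    have pos: "0 < v \<bullet> v" by (rule scalar_prod_self_pos[OF v False])
    have r: "r > 0" "r * r = v \<bullet> v" using pos by (auto simp: r_def)
    let ?u = "(1 / r) \<cdot>\<^sub>v v"
    have u1: "?u \<bullet> ?u = 1" using v r(1) by (simp add: r(2)[symmetric])
    have u: "?u \<in> carrier_vec n" using v by simp
    have "?u \<bullet> (A *\<^sub>v ?u) \<in> S"
      unfolding S_def by (intro CollectI exI[of _ "?u"] conjI refl u u1)
    then have "m \<le> ?u \<bullet> (A *\<^sub>v ?u)" unfolding m_def using bdd by (intro cInf_lower)
    also have "A *\<^sub>v ?u = (1 / r) \<cdot>\<^sub>v (A *\<^sub>v v)" by (rule mult_mat_vec[OF A v])
    also have "?u \<bullet> \<dots> = (v \<bullet> (A *\<^sub>v v)) / (v \<bullet> v)"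
      using A v r by (simp add: r(2)[symmetric])
    finally show ?thesis using pos by (simp add: field_simps)
  qed
  define B where "B = char_matrix A m"
  have B: "B \<in> carrier_mat n n" using A by (simp add: B_def)
  have "A $$ (j, i) = A $$ (i, j)" if "i < n" "j < n" for i j
    using arg_cong[OF sym, of "\<lambda>M. M $$ (i, j)"] that A by simp
  then have Bsym: "B\<^sup>T = B"
    using A by (intro eq_matI) (auto simp: B_def char_matrix_def)
  have BA: "v \<bullet> (B *\<^sub>v v) = v \<bullet> (A *\<^sub>v v) - m * (v \<bullet> v)" if v: "v \<in> carrier_vec n" for v
  proof -
    have "B *\<^sub>v v = A *\<^sub>v v + (- m) \<cdot>\<^sub>v v"
      by (rule eq_vecI) (use A v in \<open>auto simp: B_def char_matrix_def add_scalar_prod_distrib[of _ n]\<close>)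
    then show ?thesis using A v by (simp add: scalar_prod_add_distrib[of _ n])
  qed
  have "det B = 0"
  proof (rule ccontr)
    assume "det B \<noteq> 0"
    moreover have "0 \<le> v \<bullet> (B *\<^sub>v v)" if "v \<in> carrier_vec n" for v
      using BA[OF that] below[OF that] by simp
    ultimately obtain c where c: "c > 0" "\<And>u. u \<in> carrier_vec n \<Longrightarrow> c * (u \<bullet> u) \<le> u \<bullet> (B *\<^sub>v u)"
      by (rule psd_invertible_coercive[OF B Bsym]) auto
    have "m + c \<le> Inf S"
    proof (rule cInf_greatest[OF ne])
      fix s assume "s \<in> S"
      then obtain v where "v \<in> carrier_vec n" "v \<bullet> v = 1" "s = v \<bullet> (A *\<^sub>v v)" by (auto simp: S_def)
      then show "m + c \<le> s" using c(2)[of v] BA[of v] by simp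
    qed
    then show False using c(1) by (simp add: m_def)
  qed
  then have "eigenvalue A m" by (simp add: eigenvalue_det[OF A] B_def)
  then show ?thesis using below that by blast
qed

text \<open>Evaluating the Rayleigh bound at an eigenvector puts every eigenvalue above
  \<open>m\<close>. The roots of the characteristic polynomial make the spectrum finite, which gives
  \<open>Min\<close> its meaning.\<close>

lemma
  fixes A :: "real mat"
  assumes A: "A \<in> carrier_mat n n" and sym: "A\<^sup>T = A" and n: "0 < n"
  shows eigenvalue_lambda_min: "eigenvalue A (lambda_min A)"
    and lambda_min_Rayleigh:
      "\<And>v. v \<in> carrier_vec n \<Longrightarrow> lambda_min A * (v \<bullet> v) \<le> v \<bullet> (A *\<^sub>v v)"
    and lambda_min_le_eigenvalue: "\<And>k. eigenvalue A k \<Longrightarrow> lambda_min A \<le> k"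
proof -
  obtain m where m: "eigenvalue A m"
    "\<And>v. v \<in> carrier_vec n \<Longrightarrow> m * (v \<bullet> v) \<le> v \<bullet> (A *\<^sub>v v)"
    using symmetric_least_eigenvalue[OF assms] by blast
  have "char_poly A \<noteq> 0" using degree_monic_char_poly[OF A] by auto
  then have "finite {k. eigenvalue A k}"
    using poly_roots_finite by (simp add: eigenvalue_root_char_poly[OF A])
  moreover have least: "m \<le> k" if k: "eigenvalue A k" for k
  proof -
    obtain v where v: "v \<in> carrier_vec n" "v \<noteq> 0\<^sub>v n" "A *\<^sub>v v = k \<cdot>\<^sub>v v"
      using k A by (auto simp: eigenvalue_def eigenvector_def)
    then have "m * (v \<bullet> v) \<le> k * (v \<bullet> v)" using m(2)[OF v(1)] by simp
    then show ?thesis using scalar_prod_self_pos[OF v(1,2)] by simp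
  qed
  ultimately have eq: "lambda_min A = m"
    unfolding lambda_min_def using m(1) by (intro Min_eqI) auto
  show "eigenvalue A (lambda_min A)" using m(1) eq by simp
  show "lambda_min A * (v \<bullet> v) \<le> v \<bullet> (A *\<^sub>v v)" if "v \<in> carrier_vec n" for v
    using m(2)[OF that] eq by simp
  show "lambda_min A \<le> k" if "eigenvalue A k" for k using least[OF that] eq by simp
qed

text \<open>This translates an inequality required for all functions on the 1-sphere into an
  eigenvalue bound. The converse direction tests the form on an eigenvector for
  \<open>lambda_min A\<close>.\<close>

lemma le_lambda_min_iff:
  fixes A :: "real mat"
  assumes A: "A \<in> carrier_mat n n" and sym: "A\<^sup>T = A" and n: "0 < n"
  shows "c \<le> lambda_min A \<longleftrightarrow> (\<forall>v\<in>carrier_vec n. c * (v \<bullet> v) \<le> v \<bullet> (A *\<^sub>v v))"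
proof
  assume "c \<le> lambda_min A"
  then show "\<forall>v\<in>carrier_vec n. c * (v \<bullet> v) \<le> v \<bullet> (A *\<^sub>v v)"
    using lambda_min_Rayleigh[OF assms] scalar_prod_self_nonneg
    by (meson mult_right_mono order.trans)
next
  assume *: "\<forall>v\<in>carrier_vec n. c * (v \<bullet> v) \<le> v \<bullet> (A *\<^sub>v v)"
  obtain v where v: "v \<in> carrier_vec n" "v \<noteq> 0\<^sub>v n" "A *\<^sub>v v = lambda_min A \<cdot>\<^sub>v v"
    using eigenvalue_lambda_min[OF assms] A by (auto simp: eigenvalue_def eigenvector_def)
  then have "c * (v \<bullet> v) \<le> lambda_min A * (v \<bullet> v)" using * by fastforce
  then show "c \<le> lambda_min A" using scalar_prod_self_pos[OF v(1,2)] by simp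
qed

section \<open>Perturbing a matrix by multiples of \<open>n I - J\<close>\<close>

abbreviation ones_vec :: "nat \<Rightarrow> real vec" where
  "ones_vec n \<equiv> vec n (\<lambda>_. 1)"

lemma ones_vec_scalar_prod: "v \<in> carrier_vec n \<Longrightarrow> ones_vec n \<bullet> v = (\<Sum>i<n. v $ i)"
  by (auto simp: scalar_prod_def lessThan_atLeast0)

text \<open>The added matrix is \<open>c\<close> times the Laplacian matrix of the complete graph on
  \<open>n\<close> vertices; \<open>c = 4 / N\<close> gives the matrix of the theorem.\<close>

definition shifted_mat :: "nat \<Rightarrow> real mat \<Rightarrow> real \<Rightarrow> real mat" where
  "shifted_mat n P c = P + c \<cdot>\<^sub>m (real n \<cdot>\<^sub>m 1\<^sub>m n - ones_mat n)"

lemma shifted_mat_carrier: "P \<in> carrier_mat n n \<Longrightarrow> shifted_mat n P c \<in> carrier_mat n n"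
  by (auto simp: shifted_mat_def ones_mat_def)

lemma shifted_mat_symmetric:
  assumes P: "P \<in> carrier_mat n n" and sym: "P\<^sup>T = P"
  shows "(shifted_mat n P c)\<^sup>T = shifted_mat n P c"
proof -
  have "P $$ (j, i) = P $$ (i, j)" if "i < n" "j < n" for i j
    using arg_cong[OF sym, of "\<lambda>M. M $$ (i, j)"] that P by simp
  then show ?thesis
    using P by (intro eq_matI) (auto simp: shifted_mat_def ones_mat_def)
qed

lemma shifted_mat_mult_vec:
  assumes P: "P \<in> carrier_mat n n" and w: "w \<in> carrier_vec n"
  shows "shifted_mat n P c *\<^sub>v w =
    P *\<^sub>v w + ((c * real n) \<cdot>\<^sub>v w + (- c * (ones_vec n \<bullet> w)) \<cdot>\<^sub>v ones_vec n)"
proof (rule eq_vecI)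
  fix i assume "i < dim_vec (P *\<^sub>v w + ((c * real n) \<cdot>\<^sub>v w + (- c * (ones_vec n \<bullet> w)) \<cdot>\<^sub>v ones_vec n))"
  then have i: "i < n" using P w by simp
  have "(shifted_mat n P c *\<^sub>v w) $ i =
      (\<Sum>j<n. (P $$ (i, j) + c * (real n * (if i = j then 1 else 0) - 1)) * w $ j)"
    using P w i by (auto simp: shifted_mat_def ones_mat_def scalar_prod_def lessThan_atLeast0 intro!: sum.cong)
  also have "\<dots> = (\<Sum>j<n. P $$ (i, j) * w $ j + ((if i = j then c * real n * w $ j else 0) - c * w $ j))"
    by (intro sum.cong refl) (simp add: algebra_simps)
  also have "\<dots> = (\<Sum>j<n. P $$ (i, j) * w $ j) + (c * real n * w $ i - c * (\<Sum>j<n. w $ j))"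
    using i by (simp add: sum.distrib sum_subtractf sum_distrib_left)
  also have "(\<Sum>j<n. P $$ (i, j) * w $ j) = (P *\<^sub>v w) $ i"
    using P w i by (simp add: scalar_prod_def lessThan_atLeast0)
  finally show "(shifted_mat n P c *\<^sub>v w) $ i =
      (P *\<^sub>v w + ((c * real n) \<cdot>\<^sub>v w + (- c * (ones_vec n \<bullet> w)) \<cdot>\<^sub>v ones_vec n)) $ i"
    using P w i by (simp add: ones_vec_scalar_prod[OF w])
qed (use P w in \<open>simp add: shifted_mat_def ones_mat_def\<close>)

lemma shifted_mat_form:
  assumes P: "P \<in> carrier_mat n n" and v: "v \<in> carrier_vec n"
  shows "v \<bullet> (shifted_mat n P c *\<^sub>v v) =
    v \<bullet> (P *\<^sub>v v) + c * (real n * (v \<bullet> v) - (ones_vec n \<bullet> v)\<^sup>2)"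
proof -
  have "v \<bullet> ones_vec n = ones_vec n \<bullet> v" by (rule comm_scalar_prod[OF v]) simp
  then show ?thesis
    using P v
    by (simp add: shifted_mat_mult_vec scalar_prod_add_distrib[of _ n] power2_eq_square algebra_simps)
qed

text \<open>The added matrix vanishes on constant vectors, where \<open>P\<close> has eigenvalue 0, and is
  \<open>c n\<close> times the identity on their orthogonal complement.\<close>

lemma lambda_min_shifted_mat:
  assumes P: "P \<in> carrier_mat n n" and sym: "P\<^sup>T = P" and n: "0 < n"
    and null: "P *\<^sub>v ones_vec n = 0\<^sub>v n" and c: "0 \<le> c"
  shows "lambda_min P \<le> 0"
    and "lambda_min (shifted_mat n P c) = min 0 (lambda_min P + c * real n)"
proof -
  let ?M = "shifted_mat n P c"
  let ?m = "min 0 (lambda_min P + c * real n)"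
  note M = shifted_mat_carrier[OF P, of c]
  note Msym = shifted_mat_symmetric[OF P sym, of c]
  have one: "ones_vec n \<in> carrier_vec n" by simp
  have oo: "ones_vec n \<bullet> ones_vec n = real n" by (simp add: ones_vec_scalar_prod)
  have one0: "ones_vec n \<noteq> 0\<^sub>v n"
    using n by (metis index_vec index_zero_vec(1) zero_neq_one)
  have z: "0 \<cdot>\<^sub>v ones_vec n = 0\<^sub>v n" by (intro eq_vecI) auto
  have "eigenvalue P 0"
    using P one one0 null z unfolding eigenvalue_def eigenvector_def by (metis carrier_matD(1))
  then show nonpos: "lambda_min P \<le> 0" by (rule lambda_min_le_eigenvalue[OF P sym n])

  have "?M *\<^sub>v ones_vec n = 0 \<cdot>\<^sub>v ones_vec n"
    by (rule eq_vecI) (use P in \<open>auto simp: shifted_mat_mult_vec[OF P one] null oo\<close>)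
  then have "eigenvalue ?M 0"
    using M one one0 unfolding eigenvalue_def eigenvector_def by (metis carrier_matD(1))
  then have up0: "lambda_min ?M \<le> 0" by (rule lambda_min_le_eigenvalue[OF M Msym n])
  \<comment> \<open>A nonzero \<open>lambda_min P\<close> differs from the eigenvalue 0 of the
    constants, so its eigenvectors are orthogonal to them and are shifted by exactly
    \<open>c n\<close>.\<close>
  have up1: "lambda_min ?M \<le> lambda_min P + c * real n" if neg: "lambda_min P \<noteq> 0"
  proof -
    obtain w where w: "w \<in> carrier_vec n" "w \<noteq> 0\<^sub>v n" "P *\<^sub>v w = lambda_min P \<cdot>\<^sub>v w"
      using eigenvalue_lambda_min[OF P sym n] P by (auto simp: eigenvalue_def eigenvector_def)
    have "lambda_min P * (ones_vec n \<bullet> w) = (P *\<^sub>v ones_vec n) \<bullet> w"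
      using symmetric_scalar_prod[OF P sym one w(1)] w by simp
    then have "ones_vec n \<bullet> w = 0" using null w(1) neg by simp
    then have "?M *\<^sub>v w = (lambda_min P + c * real n) \<cdot>\<^sub>v w"
      by (intro eq_vecI) (use w in \<open>auto simp: shifted_mat_mult_vec[OF P w(1)] algebra_simps\<close>)
    then have "eigenvalue ?M (lambda_min P + c * real n)"
      using M w by (auto simp: eigenvalue_def eigenvector_def)
    then show ?thesis by (rule lambda_min_le_eigenvalue[OF M Msym n])
  qed
  have "?m * (v \<bullet> v) \<le> v \<bullet> (?M *\<^sub>v v)" if v: "v \<in> carrier_vec n" for v
  proof -
    \<comment> \<open>\<open>a\<close> is the mean of the entries, so \<open>u\<close> is the
      projection of \<open>v\<close> orthogonal to the constants.\<close>
    define a where "a = (ones_vec n \<bullet> v) / real n"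
    define u where "u = v + (- a) \<cdot>\<^sub>v ones_vec n"
    have u: "u \<in> carrier_vec n" using v by (simp add: u_def)
    have vu: "v = u + a \<cdot>\<^sub>v ones_vec n"
      by (rule eq_vecI) (use v in \<open>auto simp: u_def\<close>)
    have ov: "ones_vec n \<bullet> v = a * real n" using n by (simp add: a_def)
    have ou: "ones_vec n \<bullet> u = 0"
      using v ov oo unfolding u_def by (simp add: scalar_prod_add_distrib[of _ n])
    then have uo: "u \<bullet> ones_vec n = 0" using comm_scalar_prod[OF u one] by simp
    have "a \<cdot>\<^sub>v 0\<^sub>v n = 0\<^sub>v n" by (intro eq_vecI) auto
    then have "P *\<^sub>v v = P *\<^sub>v u"
      unfolding vu using P u
      by (simp add: mult_add_distrib_mat_vec[OF P] mult_mat_vec[OF P one] null)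
    moreover have "ones_vec n \<bullet> (P *\<^sub>v u) = 0"
      using symmetric_scalar_prod[OF P sym one u] null u by simp
    ultimately have form: "v \<bullet> (P *\<^sub>v v) = u \<bullet> (P *\<^sub>v u)"
      using P u by (simp add: vu add_scalar_prod_distrib[of _ n])
    have norm: "v \<bullet> v = u \<bullet> u + a\<^sup>2 * real n"
      unfolding vu using u uo ou oo
      by (simp add: add_scalar_prod_distrib[of _ n] scalar_prod_add_distrib[of _ n] power2_eq_square)
    \<comment> \<open>The constant part adds \<open>a^2 n\<close> to the squared norm and nothing to
      the form; as \<open>?m\<close> is at most 0, dropping it only increases the left-hand
      side.\<close>
    have "?m * (v \<bullet> v) \<le> ?m * (u \<bullet> u)"
      using norm by (intro mult_left_mono_neg) auto
    also have "\<dots> \<le> (lambda_min P + c * real n) * (u \<bullet> u)"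
      by (intro mult_right_mono scalar_prod_self_nonneg) simp
    also have "\<dots> \<le> u \<bullet> (P *\<^sub>v u) + c * real n * (u \<bullet> u)"
      using lambda_min_Rayleigh[OF P sym n u] by (simp add: algebra_simps)
    also have "\<dots> = v \<bullet> (?M *\<^sub>v v)"
      unfolding shifted_mat_form[OF P v] form norm ov by (simp add: power2_eq_square algebra_simps)
    finally show ?thesis .
  qed
  then have "?m \<le> lambda_min ?M" using le_lambda_min_iff[OF M Msym n] by blast
  \<comment> \<open>If \<open>lambda_min P = 0\<close>, then \<open>c >= 0\<close> makes the minimum
    0 and \<open>up0\<close> suffices.\<close>
  moreover have "lambda_min ?M \<le> ?m"
    using up0 up1 c by (cases "lambda_min P = 0") auto
  ultimately show "lambda_min ?M = ?m" by (rule antisym[rotated])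
qed

text \<open>The rows of the matrix sum to zero, so its form is a Dirichlet form with weights
  \<open>- p\<close>: each row yields the terms \<open>v i * v j - (v i)^2\<close>, and averaging
  with the roles of \<open>i\<close> and \<open>j\<close> exchanged turns them into
  \<open>- (v i - v j)^2 / 2\<close>.\<close>

lemma sum_offdiag_form:
  fixes p :: "'b \<Rightarrow> 'b \<Rightarrow> real"
  assumes "finite S" and sym: "\<And>i j. p i j = p j i"
  shows "(\<Sum>i\<in>S. \<Sum>j\<in>S. (if i \<noteq> j then p i j else - (\<Sum>k\<in>S - {i}. p i k)) * v i * v j) =
    - 1 / 2 * (\<Sum>i\<in>S. \<Sum>j\<in>S. p i j * (v i - v j)\<^sup>2)"
proof -
  have "(\<Sum>j\<in>S. (if i \<noteq> j then p i j else - (\<Sum>k\<in>S - {i}. p i k)) * v i * v j) =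
      (\<Sum>j\<in>S. p i j * (v i * v j - (v i)\<^sup>2))" if i: "i \<in> S" for i
  proof -
    have "(\<Sum>j\<in>S. (if i \<noteq> j then p i j else - (\<Sum>k\<in>S - {i}. p i k)) * v i * v j) =
        - (\<Sum>k\<in>S - {i}. p i k) * v i * v i
        + (\<Sum>j\<in>S - {i}. (if i \<noteq> j then p i j else - (\<Sum>k\<in>S - {i}. p i k)) * v i * v j)"
      by (rule sum.remove[OF assms(1) i, THEN trans]) simp
    also have "(\<Sum>j\<in>S - {i}. (if i \<noteq> j then p i j else - (\<Sum>k\<in>S - {i}. p i k)) * v i * v j) =
        (\<Sum>j\<in>S - {i}. p i j * v i * v j)"
      by (intro sum.cong refl) auto
    also have "- (\<Sum>k\<in>S - {i}. p i k) * v i * v i + (\<Sum>j\<in>S - {i}. p i j * v i * v j) =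
        (\<Sum>j\<in>S - {i}. p i j * v i * v j - p i j * v i * v i)"
      by (simp add: sum_distrib_right sum_subtractf)
    also have "\<dots> = (\<Sum>j\<in>S - {i}. p i j * (v i * v j - (v i)\<^sup>2))"
      by (intro sum.cong refl) (simp add: power2_eq_square algebra_simps)
    also have "\<dots> = (\<Sum>j\<in>S. p i j * (v i * v j - (v i)\<^sup>2))"
      by (subst sum.remove[OF assms(1) i]) (simp add: power2_eq_square)
    finally show ?thesis .
  qed
  then have "(\<Sum>i\<in>S. \<Sum>j\<in>S. (if i \<noteq> j then p i j else - (\<Sum>k\<in>S - {i}. p i k)) * v i * v j) =
      (\<Sum>i\<in>S. \<Sum>j\<in>S. p i j * (v i * v j - (v i)\<^sup>2))"
    by (rule sum.cong[OF refl])
  also have "\<dots> = ((\<Sum>i\<in>S. \<Sum>j\<in>S. p i j * (v i * v j - (v i)\<^sup>2)) +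
      (\<Sum>j\<in>S. \<Sum>i\<in>S. p i j * (v i * v j - (v i)\<^sup>2))) / 2"
    by (subst (3) sum.swap) simp
  also have "\<dots> = (\<Sum>i\<in>S. \<Sum>j\<in>S. (p i j * (v i * v j - (v i)\<^sup>2) + p j i * (v j * v i - (v j)\<^sup>2)) / 2)"
    by (simp add: sum.distrib sum_divide_distrib[symmetric])
  also have "\<dots> = (\<Sum>i\<in>S. \<Sum>j\<in>S. - 1 / 2 * (p i j * (v i - v j)\<^sup>2))"
    by (intro sum.cong refl) (simp add: sym[of _ "_ :: 'b"] power2_eq_square field_simps)
  finally show ?thesis by (simp add: sum_distrib_left)
qed

subsection \<open>The operators at a vertex\<close>

text \<open>The infimum over no walks is infinite, and a nonempty set of \<open>enat\<close>
  contains its infimum, so a finite distance is attained by a walk. It serves to identify the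
  spheres of radius 1 and 2.\<close>

lemma gdist_eq_enat_iff:
  "gdist E u v = enat r \<longleftrightarrow>
     (u, v) \<in> {(a, b). {a, b} \<in> E} ^^ r \<and> (\<forall>k<r. (u, v) \<notin> {(a, b). {a, b} \<in> E} ^^ k)"
    (is "_ \<longleftrightarrow> _ \<in> ?R ^^ r \<and> _")
proof -
  let ?W = "{k. (u, v) \<in> ?R ^^ k}"
  show ?thesis
  proof
    assume d: "gdist E u v = enat r"
    then have ne: "?W \<noteq> {}" by (metis gdist_def image_empty Inf_enat_def enat.distinct(1))
    then have "Inf (enat ` ?W) \<in> enat ` ?W"
      unfolding Inf_enat_def by (auto intro: LeastI)
    then have "(u, v) \<in> ?R ^^ r" using d by (auto simp: gdist_def)
    moreover have "r \<le> k" if "(u, v) \<in> ?R ^^ k" for k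
      using INF_lower[of k ?W enat] that d by (simp add: gdist_def)
    ultimately show "(u, v) \<in> ?R ^^ r \<and> (\<forall>k<r. (u, v) \<notin> ?R ^^ k)"
      using leD by blast
  next
    assume r: "(u, v) \<in> ?R ^^ r \<and> (\<forall>k<r. (u, v) \<notin> ?R ^^ k)"
    show "gdist E u v = enat r"
      unfolding gdist_def
    proof (rule antisym)
      show "(INF k\<in>?W. enat k) \<le> enat r" using r by (intro INF_lower) simp
      show "enat r \<le> (INF k\<in>?W. enat k)"
        using r by (intro INF_greatest) (auto simp: not_less[symmetric])
    qed
  qed
qed

lemma Gamma_op_sum:
  "Gamma_op E f g u = (\<Sum>v\<in>nbrs E u. (f v - f u) * (g v - g u)) / 2"
  by (simp add: Gamma_op_def laplacian_def sum_distrib_left sum_subtractf[symmetric] algebra_simps)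

text \<open>Both sides are twice the weighted variance of \<open>h\<close> times the square of the
  total weight. The weights are edge weights at a vertex of the 2-sphere, or constantly 1 on the
  1-sphere.\<close>

lemma sum_sum_diff_squares:
  fixes c h :: "'b \<Rightarrow> real"
  shows "(\<Sum>y\<in>S. \<Sum>w\<in>S. c y * c w * (h y - h w)\<^sup>2) =
    2 * (\<Sum>y\<in>S. c y) * (\<Sum>y\<in>S. c y * (h y)\<^sup>2) - 2 * (\<Sum>y\<in>S. c y * h y)\<^sup>2"
proof -
  have "c y * c w * (h y - h w)\<^sup>2 =
      c w * (c y * (h y)\<^sup>2) + c y * (c w * (h w)\<^sup>2) - 2 * ((c y * h y) * (c w * h w))" for y w
    by (simp add: power2_eq_square algebra_simps)
  then show ?thesis
    by (simp add: sum.distrib sum_subtractf sum_distrib_left[symmetric] sum_distrib_right[symmetric]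
        power2_eq_square)
qed

text \<open>As a function of \<open>g\<close> the left side is a parabola with its minimum at twice
  the weighted mean of \<open>h\<close>. The minimum value is a variance, spread over pairs; its
  factor \<open>1 / n\<close> becomes the \<open>1 / d_z^-\<close> in
  \<open>P_offdiag\<close>.\<close>

lemma weighted_square_decomposition:
  fixes c h :: "'b \<Rightarrow> real" and g :: real and S :: "'b set"
  defines "n \<equiv> (\<Sum>y\<in>S. c y)"
  assumes n: "n > 0"
  shows "(\<Sum>y\<in>S. c y * ((g - 2 * h y)\<^sup>2 / 2)) =
    n / 2 * (g - 2 * ((\<Sum>y\<in>S. c y * h y) / n))\<^sup>2
    + (\<Sum>y\<in>S. \<Sum>w\<in>S. c y * c w / n * (h y - h w)\<^sup>2)"
proof -
  let ?A = "\<Sum>y\<in>S. c y * h y" and ?B = "\<Sum>y\<in>S. c y * (h y)\<^sup>2"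
  have "c y * ((g - 2 * h y)\<^sup>2 / 2) = c y * (g\<^sup>2 / 2) - 2 * g * (c y * h y) + 2 * (c y * (h y)\<^sup>2)" for y
    by (simp add: power2_eq_square field_simps)
  then have lhs: "(\<Sum>y\<in>S. c y * ((g - 2 * h y)\<^sup>2 / 2)) = n * (g\<^sup>2 / 2) - 2 * g * ?A + 2 * ?B"
    by (simp only: sum.distrib sum_subtractf sum_distrib_left sum_distrib_right n_def)
  have "(\<Sum>y\<in>S. \<Sum>w\<in>S. c y * c w / n * (h y - h w)\<^sup>2) =
      (\<Sum>y\<in>S. \<Sum>w\<in>S. c y * c w * (h y - h w)\<^sup>2) / n"
    by (simp add: sum_divide_distrib)
  then have rhs: "(\<Sum>y\<in>S. \<Sum>w\<in>S. c y * c w / n * (h y - h w)\<^sup>2) = (2 * n * ?B - 2 * ?A\<^sup>2) / n"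
    by (simp only: sum_sum_diff_squares n_def)
  show ?thesis unfolding lhs rhs using n by (simp add: power2_eq_square field_simps)
qed

section \<open>Spheres around a vertex and sums over neighbourhoods\<close>

locale vertex_in_graph =
  fixes V :: "'a set" and E :: "'a set set" and x :: 'a
  assumes simple: "simple_graph V E" and locfin: "locally_finite V E" and xV: "x \<in> V"
begin

abbreviation "S1 \<equiv> nbrs E x"
abbreviation "S2 \<equiv> gsphere V E 2 x"

lemma nbrs_commute: "v \<in> nbrs E u \<longleftrightarrow> u \<in> nbrs E v"
  by (simp add: nbrs_def insert_commute)

lemma not_nbr_self: "u \<notin> nbrs E u"
  using simple by (auto simp: nbrs_def simple_graph_def)

lemma nbrs_in_V: "v \<in> nbrs E u \<Longrightarrow> v \<in> V"
  using simple by (auto simp: nbrs_def simple_graph_def)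

lemma edge_weight_nbrs: "edge_weight E u v = (if v \<in> nbrs E u then 1 else 0)"
  by (simp add: edge_weight_def nbrs_def)

lemma edge_weight_commute: "edge_weight E u v = edge_weight E v u"
  by (simp add: edge_weight_def insert_commute)

lemma P_offdiag_commute: "P_offdiag V E x u v = P_offdiag V E x v u"
  unfolding P_offdiag_def by (simp only: edge_weight_commute mult.commute)

lemma gsphere_1: "gsphere V E 1 x = S1"
  using not_nbr_self[of x] nbrs_in_V
  by (auto simp: gsphere_def gdist_eq_enat_iff nbrs_def)

lemma gsphere_2: "S2 = {z. z \<noteq> x \<and> z \<notin> S1 \<and> (\<exists>y\<in>S1. z \<in> nbrs E y)}"
proof -
  have "(x, z) \<in> {(a, b). {a, b} \<in> E} ^^ 2 \<longleftrightarrow> (\<exists>y\<in>S1. z \<in> nbrs E y)" for z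
    by (auto simp: numeral_2_eq_2 nbrs_def)
  moreover have "(\<forall>k<2::nat. Q k) \<longleftrightarrow> Q 0 \<and> Q 1" for Q
    by (auto simp: numeral_2_eq_2 less_Suc_eq)
  ultimately show ?thesis
    using nbrs_in_V by (auto simp: gsphere_def gdist_eq_enat_iff nbrs_def)
qed

lemma finite_S1: "finite S1"
  using locfin xV by (auto simp: locally_finite_def)

lemma finite_nbrs: "y \<in> S1 \<Longrightarrow> finite (nbrs E y)"
  using locfin nbrs_in_V by (auto simp: locally_finite_def)

lemma finite_S2: "finite S2"
  by (rule finite_subset[of _ "\<Union>y\<in>S1. nbrs E y"]) (auto simp: gsphere_2 finite_S1 finite_nbrs)

lemma sum_edge_weight:
  assumes "finite S"
  shows "(\<Sum>w\<in>S. edge_weight E u w * F w) = (\<Sum>w\<in>nbrs E u \<inter> S. F w)"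
  using assms by (auto simp: edge_weight_nbrs sum.inter_restrict Int_commute intro!: sum.cong)

text \<open>A neighbour of \<open>y\<close> is \<open>x\<close> itself or lies in one of the two
  spheres. Edge weights make the index sets independent of \<open>y\<close>, so that double sums can
  be exchanged.\<close>

lemma sum_nbrs:
  assumes y: "y \<in> S1"
  shows "(\<Sum>w\<in>nbrs E y. F w) =
    F x + (\<Sum>w\<in>S1. edge_weight E y w * F w) + (\<Sum>z\<in>S2. edge_weight E y z * F z)"
proof -
  have "nbrs E y = insert x ((nbrs E y \<inter> S1) \<union> (nbrs E y \<inter> S2))"
    using y nbrs_commute by (auto simp: gsphere_2)
  then have "(\<Sum>w\<in>nbrs E y. F w) = (\<Sum>w\<in>insert x ((nbrs E y \<inter> S1) \<union> (nbrs E y \<inter> S2)). F w)"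
    by simp
  also have "\<dots> = F x + ((\<Sum>w\<in>nbrs E y \<inter> S1. F w) + (\<Sum>z\<in>nbrs E y \<inter> S2. F z))"
    using not_nbr_self[of x] finite_S1 finite_S2
    by (subst sum.insert) (auto simp: gsphere_2 intro!: sum.union_disjoint)
  finally show ?thesis by (simp add: sum_edge_weight finite_S1 finite_S2)
qed

lemma out_deg_sum: "real (out_deg V E x y) = (\<Sum>z\<in>S2. edge_weight E y z)"
  using sum_edge_weight[OF finite_S2, of y "\<lambda>_. 1"] by (simp add: out_deg_def)

lemma in_deg_sum: "real (in_deg V E x z) = (\<Sum>y\<in>S1. edge_weight E y z)"
  using sum_edge_weight[OF finite_S1, of z "\<lambda>_. 1"]
  by (simp only: in_deg_def gsphere_1 edge_weight_commute) simp

lemma in_deg_pos: "z \<in> S2 \<Longrightarrow> 0 < in_deg V E x z"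
  using finite_S1 nbrs_commute unfolding in_deg_def gsphere_1 by (auto simp: gsphere_2 card_gt_0_iff)

text \<open>Only differences of \<open>f\<close> matter, hence the normalization at
  \<open>x\<close>. A walk \<open>x, y, w\<close> contributes \<open>(h w - h y)^2 / 2\<close>
  through the Laplacian of \<open>Gamma_op\<close> and \<open>- h y * (h w - h y)\<close> through
  the two equal mixed terms.\<close>

lemma Gamma2_op_sum:
  fixes f
  defines "h \<equiv> \<lambda>u. f u - f x"
  shows "2 * Gamma2_op E f f x =
    (\<Sum>y\<in>S1. \<Sum>w\<in>nbrs E y. (h w)\<^sup>2 / 2 - 2 * h w * h y + 3 / 2 * (h y)\<^sup>2)
    - real (vdeg E x) / 2 * (\<Sum>y\<in>S1. (h y)\<^sup>2) + (\<Sum>y\<in>S1. h y)\<^sup>2"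
proof -
  let ?s = "\<Sum>y\<in>S1. h y" and ?Q = "\<Sum>y\<in>S1. (h y)\<^sup>2"
  have lap: "laplacian E f u = (\<Sum>w\<in>nbrs E u. h w - h u)" for u
    by (simp add: laplacian_def h_def)
  have "laplacian E (Gamma_op E f f) x = (\<Sum>y\<in>S1. (\<Sum>w\<in>nbrs E y. (h w - h y)\<^sup>2 / 2) - ?Q / 2)"
    by (simp add: laplacian_def Gamma_op_sum h_def power2_eq_square sum_divide_distrib)
  also have "\<dots> = (\<Sum>y\<in>S1. \<Sum>w\<in>nbrs E y. (h w - h y)\<^sup>2 / 2) - real (vdeg E x) / 2 * ?Q"
    by (simp add: sum_subtractf vdeg_def)
  finally have 1: "laplacian E (Gamma_op E f f) x =
      (\<Sum>y\<in>S1. \<Sum>w\<in>nbrs E y. (h w - h y)\<^sup>2 / 2) - real (vdeg E x) / 2 * ?Q" .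
  have lapx: "laplacian E f x = ?s" by (simp add: lap) (simp add: h_def)
  have "2 * Gamma_op E f (laplacian E f) x = (\<Sum>y\<in>S1. h y * (laplacian E f y - ?s))"
    by (simp add: Gamma_op_sum lapx) (simp add: h_def)
  also have "\<dots> = (\<Sum>y\<in>S1. \<Sum>w\<in>nbrs E y. h y * (h w - h y)) - ?s\<^sup>2"
    by (simp add: right_diff_distrib[of "h _" "laplacian E f _"] sum_subtractf
        sum_distrib_right[symmetric] power2_eq_square)
       (simp add: lap sum_distrib_left)
  finally have 2: "2 * Gamma_op E f (laplacian E f) x =
      (\<Sum>y\<in>S1. \<Sum>w\<in>nbrs E y. h y * (h w - h y)) - ?s\<^sup>2" .
  have "Gamma_op E (laplacian E f) f x = Gamma_op E f (laplacian E f) x"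
    by (simp add: Gamma_op_sum mult.commute)
  then have "2 * Gamma2_op E f f x =
      laplacian E (Gamma_op E f f) x - 2 * Gamma_op E f (laplacian E f) x"
    by (simp add: Gamma2_op_def)
  also have "\<dots> = (\<Sum>y\<in>S1. \<Sum>w\<in>nbrs E y. (h w - h y)\<^sup>2 / 2 - h y * (h w - h y))
      - real (vdeg E x) / 2 * ?Q + ?s\<^sup>2"
    unfolding 1 2 by (simp add: sum_subtractf)
  also have "(\<lambda>y. \<Sum>w\<in>nbrs E y. (h w - h y)\<^sup>2 / 2 - h y * (h w - h y)) =
      (\<lambda>y. \<Sum>w\<in>nbrs E y. (h w)\<^sup>2 / 2 - 2 * h w * h y + 3 / 2 * (h y)\<^sup>2)"
    by (intro ext sum.cong refl) (simp add: power2_eq_square field_simps)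
  finally show ?thesis .
qed

text \<open>Completing the square in the values of \<open>f\<close> on the 2-sphere; what remains is a form in the
  values on the 1-sphere, in which \<open>P_offdiag\<close> appears.\<close>

lemma Gamma2_op_decomposition:
  fixes f
  defines "h \<equiv> \<lambda>u. f u - f x"
  shows "2 * Gamma2_op E f f x =
    (\<Sum>y\<in>S1. (3 + real (vdeg E x) - real (out_deg V E x y)) / 2 * (h y)\<^sup>2)
    - 1 / 4 * (\<Sum>u\<in>S1. \<Sum>v\<in>S1. P_offdiag V E x u v * (h u - h v)\<^sup>2)
    + (\<Sum>z\<in>S2. real (in_deg V E x z) / 2 *
        (h z - 2 * ((\<Sum>y\<in>S1. edge_weight E y z * h y) / real (in_deg V E x z)))\<^sup>2)"
proof -
  define d where "d = real (vdeg E x)"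
  define Q where "Q = (\<Sum>y\<in>S1. (h y)\<^sup>2)"
  define s where "s = (\<Sum>y\<in>S1. h y)"
  define T where "T = (\<Sum>u\<in>S1. \<Sum>v\<in>S1. edge_weight E u v * (h u - h v)\<^sup>2)"
  define O2 where "O2 = (\<Sum>y\<in>S1. real (out_deg V E x y) * (h y)\<^sup>2)"
  define R where "R = (\<Sum>z\<in>S2. real (in_deg V E x z) / 2 *
        (h z - 2 * ((\<Sum>y\<in>S1. edge_weight E y z * h y) / real (in_deg V E x z)))\<^sup>2)"
  define U where "U = (\<Sum>u\<in>S1. \<Sum>v\<in>S1. (\<Sum>z\<in>S2. edge_weight E u z * edge_weight E z v /
        real (in_deg V E x z)) * (h u - h v)\<^sup>2)"
  \<comment> \<open>The contribution of the walk \<open>x, y, w\<close> from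
    \<open>Gamma2_op_sum\<close>.\<close>
  define G where "G w y = (h w)\<^sup>2 / 2 - 2 * h w * h y + 3 / 2 * (h y)\<^sup>2" for w y
  have x0: "h x = 0" by (simp add: h_def)
  have card: "real (card S1) = d" by (simp add: d_def vdeg_def)

  \<comment> \<open>Each edge inside the 1-sphere is walked in both directions, and
    \<open>G w y + G y w = 2 * (h w - h y)^2\<close>.\<close>
  have "(\<Sum>y\<in>S1. \<Sum>w\<in>S1. edge_weight E y w * G w y) =
      ((\<Sum>y\<in>S1. \<Sum>w\<in>S1. edge_weight E y w * G w y) + (\<Sum>w\<in>S1. \<Sum>y\<in>S1. edge_weight E y w * G w y)) / 2"
    by (subst (3) sum.swap) simp
  also have "\<dots> = (\<Sum>y\<in>S1. \<Sum>w\<in>S1. (edge_weight E y w * G w y + edge_weight E w y * G y w) / 2)"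
    by (simp add: sum.distrib sum_divide_distrib[symmetric])
  also have "\<dots> = T"
    unfolding T_def
    by (intro sum.cong refl)
       (simp add: edge_weight_commute[of _ "_ :: 'a"] edge_weight_nbrs nbrs_commute G_def power2_eq_square field_simps)
  finally have inner: "(\<Sum>y\<in>S1. \<Sum>w\<in>S1. edge_weight E y w * G w y) = T" .

  \<comment> \<open>\<open>G z y\<close> is \<open>(h z - 2 * h y)^2 / 2\<close> minus
    \<open>(h y)^2 / 2\<close>; the subtracted part, counted once per outward edge, brings in the
    out-degree.\<close>
  have "(\<Sum>y\<in>S1. \<Sum>z\<in>S2. edge_weight E y z * G z y) =
      (\<Sum>y\<in>S1. \<Sum>z\<in>S2. edge_weight E y z * ((h z - 2 * h y)\<^sup>2 / 2) - edge_weight E y z * (h y)\<^sup>2 / 2)"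
    by (intro sum.cong refl) (simp add: G_def power2_eq_square field_simps)
  also have "\<dots> = (\<Sum>z\<in>S2. \<Sum>y\<in>S1. edge_weight E y z * ((h z - 2 * h y)\<^sup>2 / 2)) - O2 / 2"
    by (subst (2) sum.swap)
       (simp add: sum_subtractf O2_def out_deg_sum sum_divide_distrib sum_distrib_right)
  also have "(\<Sum>z\<in>S2. \<Sum>y\<in>S1. edge_weight E y z * ((h z - 2 * h y)\<^sup>2 / 2)) =
      R + (\<Sum>z\<in>S2. \<Sum>u\<in>S1. \<Sum>v\<in>S1. edge_weight E u z * edge_weight E v z /
        real (in_deg V E x z) * (h u - h v)\<^sup>2)"
    unfolding R_def sum.distrib[symmetric]
  proof (intro sum.cong refl)
    fix z assume "z \<in> S2"
    then have "0 < (\<Sum>y\<in>S1. edge_weight E y z)" using in_deg_pos by (simp add: in_deg_sum[symmetric])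
    from weighted_square_decomposition[OF this, of "h z" h]
    show "(\<Sum>y\<in>S1. edge_weight E y z * ((h z - 2 * h y)\<^sup>2 / 2)) =
      real (in_deg V E x z) / 2 *
        (h z - 2 * ((\<Sum>y\<in>S1. edge_weight E y z * h y) / real (in_deg V E x z)))\<^sup>2
      + (\<Sum>u\<in>S1. \<Sum>v\<in>S1. edge_weight E u z * edge_weight E v z /
        real (in_deg V E x z) * (h u - h v)\<^sup>2)"
      by (simp only: in_deg_sum)
  qed
  also have "(\<Sum>z\<in>S2. \<Sum>u\<in>S1. \<Sum>v\<in>S1. edge_weight E u z * edge_weight E v z /
        real (in_deg V E x z) * (h u - h v)\<^sup>2) =
      (\<Sum>u\<in>S1. \<Sum>v\<in>S1. \<Sum>z\<in>S2. edge_weight E u z * edge_weight E v z /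
        real (in_deg V E x z) * (h u - h v)\<^sup>2)"
    by (subst sum.swap) (intro sum.cong refl sum.swap)
  also have "\<dots> = U"
    unfolding U_def sum_distrib_right by (simp only: edge_weight_commute)
  finally have outer: "(\<Sum>y\<in>S1. \<Sum>z\<in>S2. edge_weight E y z * G z y) = R + U - O2 / 2" .

  have "(\<Sum>y\<in>S1. \<Sum>w\<in>nbrs E y. G w y) =
      (\<Sum>y\<in>S1. G x y + (\<Sum>w\<in>S1. edge_weight E y w * G w y) + (\<Sum>z\<in>S2. edge_weight E y z * G z y))"
    by (intro sum.cong refl sum_nbrs)
  also have "\<dots> = 3 / 2 * Q + T + (R + U - O2 / 2)"
    by (simp only: sum.distrib inner outer) (simp add: G_def x0 Q_def sum_distrib_left)
  finally have "2 * Gamma2_op E f f x = 3 / 2 * Q + T + (R + U - O2 / 2) - d / 2 * Q + s\<^sup>2"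
    using Gamma2_op_sum[of f] by (simp add: G_def h_def Q_def d_def s_def)
  \<comment> \<open>Multiplied by \<open>- 1 / 4\<close> this is \<open>s^2 - d Q + T + U\<close>;
    compensating \<open>- d Q\<close> raises the coefficient \<open>(3 - d) / 2\<close> of
    \<open>Q\<close> to the \<open>(3 + d) / 2\<close> seen in \<open>K0_infty\<close>.\<close>
  moreover have "(\<Sum>u\<in>S1. \<Sum>v\<in>S1. P_offdiag V E x u v * (h u - h v)\<^sup>2) =
      2 * (2 * d * Q - 2 * s\<^sup>2) - 4 * T - 4 * U"
  proof -
    have "(\<Sum>u\<in>S1. \<Sum>v\<in>S1. P_offdiag V E x u v * (h u - h v)\<^sup>2) =
        2 * (\<Sum>u\<in>S1. \<Sum>v\<in>S1. (h u - h v)\<^sup>2) - 4 * T - 4 * U"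
      unfolding P_offdiag_def T_def U_def left_diff_distrib sum_subtractf mult.assoc
      by (simp only: sum_distrib_left[symmetric])
    then show ?thesis
      using sum_sum_diff_squares[of "\<lambda>_. 1" h S1] by (simp add: card Q_def s_def)
  qed
  moreover have "(\<Sum>y\<in>S1. (3 + d - real (out_deg V E x y)) / 2 * (h y)\<^sup>2) = (3 + d) / 2 * Q - O2 / 2"
    unfolding Q_def O2_def sum_distrib_left sum_divide_distrib sum_subtractf[symmetric]
    by (intro sum.cong refl) (simp add: field_simps)
  ultimately show ?thesis
    unfolding R_def[symmetric] d_def[symmetric] by (simp add: algebra_simps)
qed

end

subsection \<open>The curvature at an out-regular vertex\<close>

locale out_regular_vertex = vertex_in_graph +
  fixes y :: "nat \<Rightarrow> 'a"
  assumes deg: "1 \<le> vdeg E x" and enum: "bij_betw y {..<vdeg E x} S1"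
    and reg: "S1_out_regular V E x"
begin

abbreviation "d \<equiv> vdeg E x"
abbreviation "P \<equiv> P_infty V E x y"

section \<open>The operators at \<open>x\<close> in coordinates on the 1-sphere\<close>

definition S1_vec :: "('a \<Rightarrow> real) \<Rightarrow> real vec" where
  "S1_vec f = vec d (\<lambda>i. f (y i) - f x)"

lemma S1_vec_carrier [simp]: "S1_vec f \<in> carrier_vec d"
  by (simp add: S1_vec_def)

lemma out_deg_avg: "u \<in> S1 \<Longrightarrow> real (out_deg V E x u) = avg_out_deg V E x"
  using reg gsphere_1 by (simp add: S1_out_regular_def)

lemma sum_S1: "(\<Sum>u\<in>S1. F u) = (\<Sum>i<d. F (y i))"
  by (rule sum.reindex_bij_betw[OF enum, symmetric])

lemma P_carrier: "P \<in> carrier_mat d d"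
  by (simp add: P_infty_def)

text \<open>Out-regularity cancels the degree deviation on the diagonal, which leaves zero row
  sums.\<close>

lemma P_entry:
  assumes "i < d" "j < d"
  shows "P $$ (i, j) = (if i \<noteq> j then P_offdiag V E x (y i) (y j)
    else - (\<Sum>k\<in>{..<d} - {i}. P_offdiag V E x (y i) (y k)))"
proof -
  have "y i \<in> S1" using assms(1) enum by (auto dest: bij_betwE)
  then show ?thesis using assms by (auto simp: P_infty_def out_deg_avg)
qed

lemma P_symmetric: "P\<^sup>T = P"
  using P_carrier by (intro eq_matI) (auto simp: P_entry P_offdiag_commute)

lemma P_ones_vec: "P *\<^sub>v ones_vec d = 0\<^sub>v d"
proof (rule eq_vecI)
  fix i assume "i < dim_vec (0\<^sub>v d :: real vec)"
  then have i: "i < d" by simp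
  have "(P *\<^sub>v ones_vec d) $ i = (\<Sum>j<d. P $$ (i, j))"
    using P_carrier i by (simp add: scalar_prod_def lessThan_atLeast0)
  also have "\<dots> = P $$ (i, i) + (\<Sum>j\<in>{..<d} - {i}. P $$ (i, j))"
    using i by (intro sum.remove) auto
  also have "(\<Sum>j\<in>{..<d} - {i}. P $$ (i, j)) = (\<Sum>j\<in>{..<d} - {i}. P_offdiag V E x (y i) (y j))"
    using i by (intro sum.cong refl) (auto simp: P_entry)
  finally show "(P *\<^sub>v ones_vec d) $ i = 0\<^sub>v d $ i" using i by (simp add: P_entry)
qed (use P_carrier in simp)

lemma P_form:
  assumes "v \<in> carrier_vec d"
  shows "v \<bullet> (P *\<^sub>v v) =
    - 1 / 2 * (\<Sum>i<d. \<Sum>j<d. P_offdiag V E x (y i) (y j) * (v $ i - v $ j)\<^sup>2)"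
proof -
  have "v \<bullet> (P *\<^sub>v v) = (\<Sum>i<d. \<Sum>j<d. P $$ (i, j) * v $ i * v $ j)"
    by (rule quadratic_form_sum[OF P_carrier assms])
  also have "\<dots> = (\<Sum>i<d. \<Sum>j<d. (if i \<noteq> j then P_offdiag V E x (y i) (y j)
      else - (\<Sum>k\<in>{..<d} - {i}. P_offdiag V E x (y i) (y k))) * v $ i * v $ j)"
    by (intro sum.cong refl) (simp only: P_entry lessThan_iff)
  also have "\<dots> = - 1 / 2 * (\<Sum>i<d. \<Sum>j<d. P_offdiag V E x (y i) (y j) * (v $ i - v $ j)\<^sup>2)"
    by (rule sum_offdiag_form) (simp, rule P_offdiag_commute)
  finally show ?thesis .
qed

text \<open>It vanishes exactly when every increment \<open>f z - f x\<close> on the 2-sphere is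
  twice the mean of the increments at the neighbours of \<open>z\<close> in the 1-sphere.\<close>

definition S2_defect :: "('a \<Rightarrow> real) \<Rightarrow> real" where
  "S2_defect f = (\<Sum>z\<in>S2. real (in_deg V E x z) / 2 * (f z - f x
     - 2 * ((\<Sum>u\<in>S1. edge_weight E u z * (f u - f x)) / real (in_deg V E x z)))\<^sup>2)"

lemma S2_defect_nonneg: "0 \<le> S2_defect f"
  unfolding S2_defect_def by (intro sum_nonneg) auto

lemma Gamma2_op_form:
  "2 * Gamma2_op E f f x = K0_infty V E x * (S1_vec f \<bullet> S1_vec f)
    + 1 / 2 * (S1_vec f \<bullet> (P *\<^sub>v S1_vec f)) + S2_defect f"
proof -
  have "(\<Sum>u\<in>S1. (3 + real d - real (out_deg V E x u)) / 2 * (f u - f x)\<^sup>2) =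
      (\<Sum>u\<in>S1. K0_infty V E x * (f u - f x)\<^sup>2)"
    by (intro sum.cong refl) (simp add: K0_infty_def out_deg_avg)
  also have "\<dots> = K0_infty V E x * (S1_vec f \<bullet> S1_vec f)"
    by (simp add: scalar_prod_self_sum[of _ d] S1_vec_def sum_S1 sum_distrib_left)
  finally show ?thesis
    using Gamma2_op_decomposition[of f]
    by (simp add: P_form S2_defect_def) (simp add: sum_S1 S1_vec_def)
qed

lemma Gamma_op_form: "Gamma_op E f f x = (S1_vec f \<bullet> S1_vec f) / 2"
  by (simp add: Gamma_op_sum scalar_prod_self_sum[of _ d] S1_vec_def sum_S1 power2_eq_square)

lemma laplacian_form: "laplacian E f x = ones_vec d \<bullet> S1_vec f"
  by (simp add: laplacian_def ones_vec_scalar_prod) (simp add: S1_vec_def sum_S1)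

text \<open>Values on the two spheres can be chosen independently. This makes the form inequality
  necessary for the curvature condition; sufficiency comes from
  \<open>S2_defect_nonneg\<close>.\<close>

lemma S1_vec_minimizer:
  assumes v: "v \<in> carrier_vec d"
  obtains f where "S1_vec f = v" "S2_defect f = 0"
proof -
  define h where "h u = (if u \<in> S1 then v $ inv_into {..<d} y u else 0)" for u
  \<comment> \<open>On the 2-sphere \<open>f\<close> takes the minimizing value, twice the mean of
    \<open>h\<close>; \<open>x\<close> lies in neither sphere, so \<open>f x = 0\<close>.\<close>
  define f where "f u = (if u \<in> S2 then
      2 * ((\<Sum>w\<in>S1. edge_weight E w u * h w) / real (in_deg V E x u)) else h u)" for u
  have fx: "f x = 0" using not_nbr_self[of x] by (simp add: f_def h_def gsphere_2)
  have f1: "f u = h u" if "u \<in> S1" for u using that by (simp add: f_def gsphere_2)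
  have "S1_vec f = v"
  proof (rule eq_vecI)
    fix i assume "i < dim_vec v"
    then have i: "i < d" using v by simp
    then have "y i \<in> S1" using enum by (auto dest: bij_betwE)
    then show "S1_vec f $ i = v $ i"
      using i enum by (simp add: S1_vec_def fx f1 h_def bij_betw_def)
  qed (use v in \<open>simp add: S1_vec_def\<close>)
  moreover have "S2_defect f = 0"
    unfolding S2_defect_def
  proof (intro sum.neutral ballI)
    fix z assume "z \<in> S2"
    moreover have "(\<Sum>u\<in>S1. edge_weight E u z * (f u - f x)) = (\<Sum>w\<in>S1. edge_weight E w z * h w)"
      by (intro sum.cong refl) (simp add: fx f1)
    ultimately show "real (in_deg V E x z) / 2 * (f z - f x
     - 2 * ((\<Sum>u\<in>S1. edge_weight E u z * (f u - f x)) / real (in_deg V E x z)))\<^sup>2 = 0"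
      by (simp add: fx) (simp add: f_def)
  qed
  ultimately show ?thesis using that by blast
qed

lemma curvature_dim_iff:
  fixes N :: ereal
  defines "t \<equiv> real_of_ereal (1 / N)"
  shows "curvature_dim E x N K \<longleftrightarrow>
    K \<le> K0_infty V E x - 2 * real d * t + 1 / 2 * lambda_min (shifted_mat d P (4 * t))"
proof -
  let ?M = "shifted_mat d P (4 * t)"
  \<comment> \<open>The form of \<open>?M\<close> contains \<open>4 * t * d\<close> times the
    squared norm beyond what the inequality supplies; the summand \<open>2 * real d * t\<close>
    takes it back.\<close>
  let ?k = "2 * (K - K0_infty V E x + 2 * real d * t)"
  have gap: "2 * (Gamma2_op E f f x - (t * (laplacian E f x)\<^sup>2 + K * Gamma_op E f f x)) =
      (S1_vec f \<bullet> (?M *\<^sub>v S1_vec f) - ?k * (S1_vec f \<bullet> S1_vec f)) / 2 + S2_defect f" for f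
    unfolding right_diff_distrib Gamma2_op_form Gamma_op_form laplacian_form
      shifted_mat_form[OF P_carrier S1_vec_carrier]
    by (simp add: field_simps)
  have double: "0 \<le> 2 * (a - b) \<longleftrightarrow> b \<le> a" for a b :: real by auto
  have cd_iff: "curvature_dim E x N K \<longleftrightarrow>
      (\<forall>f. 0 \<le> 2 * (Gamma2_op E f f x - (t * (laplacian E f x)\<^sup>2 + K * Gamma_op E f f x)))"
    unfolding double curvature_dim_def t_def ..
  have half: "b \<le> a" if "0 \<le> (a - b) / 2 + 0" for a b :: real
    using that by simp
  have half_add: "0 \<le> (a - b) / 2 + c" if "b \<le> a" "0 \<le> c" for a b c :: real
    using that by simp
  have "curvature_dim E x N K \<longleftrightarrow> (\<forall>v\<in>carrier_vec d. ?k * (v \<bullet> v) \<le> v \<bullet> (?M *\<^sub>v v))"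
  proof
    assume cd: "curvature_dim E x N K"
    show "\<forall>v\<in>carrier_vec d. ?k * (v \<bullet> v) \<le> v \<bullet> (?M *\<^sub>v v)"
    proof
      fix v :: "real vec" assume "v \<in> carrier_vec d"
      then obtain f where f: "S1_vec f = v" "S2_defect f = 0" by (rule S1_vec_minimizer)
      have "0 \<le> 2 * (Gamma2_op E f f x - (t * (laplacian E f x)\<^sup>2 + K * Gamma_op E f f x))"
        using cd unfolding cd_iff by blast
      then show "?k * (v \<bullet> v) \<le> v \<bullet> (?M *\<^sub>v v)" unfolding gap f by (rule half)
    qed
  next
    assume form: "\<forall>v\<in>carrier_vec d. ?k * (v \<bullet> v) \<le> v \<bullet> (?M *\<^sub>v v)"
    have "0 \<le> 2 * (Gamma2_op E f f x - (t * (laplacian E f x)\<^sup>2 + K * Gamma_op E f f x))" for f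
      unfolding gap by (intro half_add S2_defect_nonneg form[rule_format] S1_vec_carrier)
    then show "curvature_dim E x N K" unfolding cd_iff by blast
  qed
  also have "\<dots> \<longleftrightarrow> ?k \<le> lambda_min ?M"
    using deg by (intro le_lambda_min_iff[symmetric] shifted_mat_carrier shifted_mat_symmetric
        P_carrier P_symmetric) simp
  also have "\<dots> \<longleftrightarrow> K \<le> K0_infty V E x - 2 * real d * t + 1 / 2 * lambda_min ?M"
    by (auto simp: field_simps)
  finally show ?thesis .
qed

text \<open>By \<open>curvature_dim_iff\<close> the admissible \<open>K\<close> form a closed
  half-line, so the greatest one is its endpoint.\<close>

lemma BE_curvature_eq:
  "BE_curvature E x N = K0_infty V E x - 2 * real d * real_of_ereal (1 / N)
    + 1 / 2 * lambda_min (shifted_mat d P (4 * real_of_ereal (1 / N)))"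
  unfolding BE_curvature_def by (rule Greatest_equality) (simp_all add: curvature_dim_iff)

text \<open>While \<open>lambda_min P + 4 d / N\<close> is nonnegative the eigenvalue term is 0.
  Once it is negative, half of it cancels \<open>- 2 d / N\<close> and leaves
  \<open>K0_infty + lambda_min P / 2\<close>, which is \<open>K0_infty - 2 d / N0\<close>.\<close>

lemma BE_curvature_threshold:
  assumes N: "0 < N"
  shows "BE_curvature E x N =
    (if N \<le> N0_thr V E x y then K0_infty V E x - 2 * real d * real_of_ereal (1 / N)
     else K0_infty V E x - 2 * real d * real_of_ereal (1 / N0_thr V E x y))"
proof -
  define t where "t = real_of_ereal (1 / N)"
  have t: "0 \<le> t" using N by (cases N) (auto simp: t_def one_ereal_def)
  have d: "0 < d" using deg by simp
  note shift = lambda_min_shifted_mat[OF P_carrier P_symmetric d P_ones_vec, of "4 * t"]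
  have lmin: "lambda_min P \<le> 0" using shift(1) t by simp
  have K: "BE_curvature E x N = K0_infty V E x - 2 * real d * t
      + 1 / 2 * min 0 (lambda_min P + 4 * t * real d)"
    using shift(2) t by (simp add: BE_curvature_eq t_def)
  show ?thesis
  proof (cases "lambda_min P = 0")
    \<comment> \<open>Here \<open>N0_thr\<close> is infinite, so the first branch always
      applies.\<close>
    case True
    then show ?thesis using K t by (simp add: N0_thr_def t_def)
  next
    case False
    then have neg: "lambda_min P < 0" using lmin by simp
    have N0: "N0_thr V E x y = ereal (4 * real d / (- lambda_min P))" using False by (simp add: N0_thr_def)
    have t0: "real_of_ereal (1 / N0_thr V E x y) = - lambda_min P / (4 * real d)"
      using neg d by (simp add: N0 one_ereal_def)
    have iff: "N \<le> N0_thr V E x y \<longleftrightarrow> 0 \<le> lambda_min P + 4 * t * real d"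
    proof (cases N)
      case (real r)
      then have "0 < r" using N by simp
      then show ?thesis using neg real by (auto simp: N0 t_def one_ereal_def field_simps)
    next
      \<comment> \<open>Both sides are false: \<open>N0_thr\<close> is finite, and
        \<open>t = 0\<close> leaves the negative \<open>lambda_min P\<close>.\<close>
      case PInf
      then show ?thesis using neg by (simp add: N0 t_def)
    next
      case MInf
      then show ?thesis using N by simp
    qed
    show ?thesis
      using d by (auto simp: K iff t0 t_def[symmetric] field_simps min_def)
  qed
qed

end

theorem theorem5p7:
  fixes V :: "'a set" and E :: "'a set set" and x :: 'a and y :: "nat \<Rightarrow> 'a" and N :: ereal
  assumes "simple_graph V E"
    and "locally_finite V E"
    and "x \<in> V"
    and "vdeg E x \<ge> 1"
    and "bij_betw y {..<vdeg E x} (gsphere V E 1 x)"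
    and "S1_out_regular V E x"
    and "0 < N"
  shows "BE_curvature E x N =
           K0_infty V E x - 2 * real (vdeg E x) * real_of_ereal (1 / N)
           + 1 / 2 * lambda_min (P_infty V E x y
               + (4 * real_of_ereal (1 / N)) \<cdot>\<^sub>m
                   (real (vdeg E x) \<cdot>\<^sub>m 1\<^sub>m (vdeg E x) - ones_mat (vdeg E x)))
         \<and> BE_curvature E x N =
           (if N \<le> N0_thr V E x y
            then K0_infty V E x - 2 * real (vdeg E x) * real_of_ereal (1 / N)
            else K0_infty V E x - 2 * real (vdeg E x) * real_of_ereal (1 / N0_thr V E x y))"
proof -
  interpret vertex_in_graph V E x using assms(1-3) by unfold_locales
  interpret out_regular_vertex V E x y
    using assms(4,5,6) gsphere_1 by unfold_locales simp_all
  show ?thesis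
    using BE_curvature_eq[unfolded shifted_mat_def] BE_curvature_threshold[OF assms(7)] by blast
qed

end
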